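(* Let $p$ be a prime and let $G$ be a finite abelian $p$-group with $\exp(G)=q$ and $\left\lceil \frac{D(G)}{q}\right\rceil = d$. If $p\ge 2d+3\left\lceil \frac{D(G)}{2q}\right\rceil-3$ and $k$ is an integer with $k\ge d$, then $$s_{kq}(G)\le (k+2d-2)\,q+3D(G)-3.$$
   Context: $\exp(G)$ is the exponent of the finite abelian group $G$ (written additively), i.e. the largest order of an element of $G$. A sequence over $G$ is a finite sequence of elements of $G$, repetitions allowed, order irrelevant (a finite multiset); its length is the number of terms counted with multiplicity; a subsequence is a sub-multiset; a sequence is zero-sum if the sum of its terms is $0$. $D(G)$ is the Davenport constant of $G$: the smallest positive integer $\ell$ such that every sequence over $G$ of length $\ell$ has a nonempty zero-sum subsequence. For a positive integer $k$, $s_k(G)$ is the smallest positive integer $\ell$ such that every sequence over $G$ of length at least $\ell$ has a zero-sum subsequence of length exactly $k$ ($s_k(G)=\infty$ if no such $\ell$ exists). *)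

theory Defs
  imports
    Complex_Main
    "HOL-Computational_Algebra.Primes"
    "HOL-Algebra.Multiplicative_Group"
    "HOL-Library.Multiset"
    "HOL-Library.Extended_Nat"
begin

text \<open>
  Abelian groups are objects of the locale \<^locale>\<open>comm_group\<close>, hence written multiplicatively:
  the sum of a sequence is a product in \<open>G\<close>, and ``zero-sum'' means that this product is
  the identity of \<open>G\<close>. A sequence over \<open>G\<close> is a multiset of elements of the carrier.
\<close>

definition seq_over :: "('a, 'b) monoid_scheme \<Rightarrow> 'a multiset \<Rightarrow> bool" where
  "seq_over G S \<longleftrightarrow> set_mset S \<subseteq> carrier G"

definition seq_sum :: "('a, 'b) monoid_scheme \<Rightarrow> 'a multiset \<Rightarrow> 'a" where
  "seq_sum G S = (\<Otimes>\<^bsub>G\<^esub>x\<in>set_mset S. x [^]\<^bsub>G\<^esub> count S x)"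

definition zero_sum :: "('a, 'b) monoid_scheme \<Rightarrow> 'a multiset \<Rightarrow> bool" where
  "zero_sum G S \<longleftrightarrow> seq_sum G S = \<one>\<^bsub>G\<^esub>"

text \<open>Only meaningful for finite groups, where the set of orders is finite and nonempty.\<close>

definition group_exp :: "('a, 'b) monoid_scheme \<Rightarrow> nat" where
  "group_exp G = Max (group.ord G ` carrier G)"

text \<open>
  Only meaningful for finite groups, where some such length exists (by the pigeonhole principle
  on partial sums, the order of \<open>G\<close> is one).
\<close>

definition davenport :: "('a, 'b) monoid_scheme \<Rightarrow> nat" where
  "davenport G = (LEAST l. l > 0 \<and>
     (\<forall>S. seq_over G S \<and> size S = l \<longrightarrow> (\<exists>T. T \<subseteq># S \<and> T \<noteq> {#} \<and> zero_sum G T)))"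

text \<open>The infimum of the empty set in \<^typ>\<open>enat\<close> is \<open>\<infinity>\<close>.\<close>

definition s_const :: "nat \<Rightarrow> ('a, 'b) monoid_scheme \<Rightarrow> enat" where
  "s_const k G = Inf (enat ` {l. l > 0 \<and>
     (\<forall>S. seq_over G S \<and> size S \<ge> l \<longrightarrow> (\<exists>T. T \<subseteq># S \<and> size T = k \<and> zero_sum G T))})"

end

theory Submission
  imports Defs "HOL-Algebra.Generated_Groups" "HOL-Number_Theory.Cong"
begin

text \<open>
  Write $D$ for the Davenport constant and call $j$ attained by $S$ if $S$ has a zero-sum
  subsequence of length $jq$. Olson's argument (products of enough differences $g - 1$ vanish in
  the group ring modulo $p$), applied to the function $(x, l) \mapsto [x = 0]\,[q \mid l]\,P(l/q)$
  with $P$ an integer polynomial of degree less than $c$, shows: if $|S| \ge D - 1 + cq$ and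
  $d + c \le p$, then every $d$-element subset of $[1, d + c - 1]$ contains an attained value;
  one lets $P$ vanish on the complement.

  Induct on $k = d + e$. We may assume that $k$ and all of $[1, e]$ are not attained by $S$, since a
  zero-sum subsequence of length $jq$ with $j \le e$ can be removed. If $e \ge d - 1$, these values
  already contradict the above. Otherwise, there are disjoint zero-sum subsequences $W_1$, $W_2$ of
  lengths $w_i q$ with $w_1 \ge 2d$ and $w_2 \ge 2d - 1$. The values attained by $W_i$ are symmetric
  under $x \mapsto w_i - x$, so $W_i$ misses at most $(d - 1)/2$ of the values in $[1, d - 1]$,
  and $W_1$ misses fewer than that if $e = 0$, because it also misses $d = k$. As both miss $[1, e]$,
  some $x \in [e + 1, d - 1]$ is attained by $W_1$ while $k - x$ is attained by $W_2$, and $k$ is attained by $S$.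
\<close>

subsection \<open>Difference operators\<close>

text \<open>With T F = F \<circ> \<phi>, this is (T - 1) F. For translations by group elements it is
  the action of g - 1, so the group ring itself need not be constructed.\<close>

definition fdiff :: "('c \<Rightarrow> 'c) \<Rightarrow> ('c \<Rightarrow> int) \<Rightarrow> 'c \<Rightarrow> int" where
  "fdiff \<phi> F = (\<lambda>z. F (\<phi> z) - F z)"

inductive_set comp_closure :: "('c \<Rightarrow> 'c) set \<Rightarrow> ('c \<Rightarrow> 'c) set" for B where
  id: "id \<in> comp_closure B"
| comp: "b \<in> B \<Longrightarrow> m \<in> comp_closure B \<Longrightarrow> b \<circ> m \<in> comp_closure B"

lemma comp_closure_incl: "b \<in> B \<Longrightarrow> b \<in> comp_closure B"
  using comp_closure.comp[OF _ comp_closure.id, of b B] by simp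

lemma comp_closure_comp:
  assumes "m \<in> comp_closure B" "m' \<in> comp_closure B"
  shows "m \<circ> m' \<in> comp_closure B"
  using assms(1)
proof induction
  case (comp b m)
  then show ?case by (metis comp_assoc comp_closure.comp)
qed (simp add: assms(2))

lemma comp_closure_funpow: "m \<in> comp_closure B \<Longrightarrow> m ^^ n \<in> comp_closure B"
  by (induction n) (auto intro: comp_closure.id comp_closure_comp)

lemma comp_closure_commute:
  assumes "m \<in> comp_closure B" and "\<And>b. b \<in> B \<Longrightarrow> b \<circ> f = f \<circ> b"
  shows "m \<circ> f = f \<circ> m"
  using assms(1)
proof induction
  case (comp b m)
  then show ?case by (metis assms(2) comp_assoc)
qed simp

lemma fdiff_commute: "\<phi> \<circ> \<psi> = \<psi> \<circ> \<phi> \<Longrightarrow> fdiff \<phi> (fdiff \<psi> F) = fdiff \<psi> (fdiff \<phi> F)"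
  by (auto simp: fdiff_def fun_eq_iff)

lemma fdiff_funpow_commute:
  "\<phi> \<circ> \<psi> = \<psi> \<circ> \<phi> \<Longrightarrow> (fdiff \<phi> ^^ n) (fdiff \<psi> F) = fdiff \<psi> ((fdiff \<phi> ^^ n) F)"
  by (induction n) (auto simp: fdiff_commute)

lemma fdiff_funpow_shift:
  assumes "\<phi> \<circ> m = m \<circ> \<phi>"
  shows "(fdiff \<phi> ^^ n) (\<lambda>z. F (m z)) = (\<lambda>z. (fdiff \<phi> ^^ n) F (m z))"
proof (induction n)
  case (Suc n)
  have "\<phi> (m z) = m (\<phi> z)" for z using assms by (metis comp_apply)
  with Suc show ?case by (simp add: fdiff_def)
qed simp

text \<open>The group ring identity gh - 1 = (g - 1) h + (h - 1), which reduces differences along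
  monomials to differences along generators.\<close>

lemma fdiff_comp: "fdiff (\<phi> \<circ> \<psi>) F = (\<lambda>z. fdiff \<phi> F (\<psi> z) + fdiff \<psi> F z)"
  by (simp add: fdiff_def)

lemma fold_fdiff_add:
  "fold fdiff ms (\<lambda>z. F z + H z) = (\<lambda>z. fold fdiff ms F z + fold fdiff ms H z)"
proof (induction ms arbitrary: F H)
  case (Cons m ms)
  have "fdiff m (\<lambda>z. F z + H z) = (\<lambda>z. fdiff m F z + fdiff m H z)"
    by (simp add: fdiff_def fun_eq_iff)
  with Cons show ?case by simp
qed simp

lemma dvd_fold_fdiff_if_dvd: "(\<And>z. p dvd F z) \<Longrightarrow> p dvd fold fdiff ms F z"
  by (induction ms arbitrary: F) (auto simp: fdiff_def)

text \<open>In algebraic terms: if commuting operators $t_b$ satisfy $(t_b - 1)^{r_b} = 0$, then every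
  product of more than $\sum_b (r_b - 1)$ factors $m - 1$, with $m$ a monomial in the $t_b$,
  vanishes.\<close>

lemma dvd_fold_fdiff:
  fixes p :: int
  assumes "finite B" and comm: "\<And>a b. a \<in> B \<Longrightarrow> b \<in> B \<Longrightarrow> a \<circ> b = b \<circ> a"
    and "set ms \<subseteq> comp_closure B"
    and "\<And>b z. b \<in> B \<Longrightarrow> p dvd (fdiff b ^^ r b) F z"
    and "(\<Sum>b\<in>B. r b) < length ms + card B"
  shows "p dvd fold fdiff ms F z"
  using assms(3-5)
proof (induction ms arbitrary: F r z)
  case Nil
  \<comment> \<open>With no factors left, the exponents sum to less than the number of generators,
    so one of them is 0 and F itself is divisible by p.\<close>
  have "\<exists>b\<in>B. r b = 0"
  proof (rule ccontr)
    assume "\<not> ?thesis"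
    then have "(\<Sum>b\<in>B. 1) \<le> (\<Sum>b\<in>B. r b)" by (intro sum_mono) (auto simp: Suc_le_eq)
    with Nil(3) show False by simp
  qed
  with Nil(2) show ?case by force
next
  case (Cons m ms)
  show ?case
  proof (cases "\<exists>b\<in>B. r b = 0")
    case True
    with Cons.prems(2) have "p dvd F z" for z by force
    then show ?thesis by (rule dvd_fold_fdiff_if_dvd)
  next
    case False
    \<comment> \<open>Induct on the monomial: by \<open>fdiff_comp\<close>, the factor for b \<circ>
      m splits into one for b, translated by m, and one for m.\<close>
    have "p dvd fold fdiff ms (fdiff m F) z" if "m \<in> comp_closure B" for m z
      using that
    proof (induction arbitrary: z)
      case id
      show ?case by (rule dvd_fold_fdiff_if_dvd) (simp add: fdiff_def)
    next
      case (comp b m)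
      have comm_m: "c \<circ> m = m \<circ> c" if "c \<in> B" for c
        using comp_closure_commute[OF comp.hyps(2), of c] comm that by simp
      \<comment> \<open>A factor for b has been spent, so one less suffices to annihilate; both
        sides of the length bound drop by one.\<close>
      define r' where "r' = r(b := r b - 1)"
      have shift: "(fdiff c ^^ n) (\<lambda>z. H (m z)) = (\<lambda>z. (fdiff c ^^ n) H (m z))" if "c \<in> B" for c n H
        by (rule fdiff_funpow_shift[OF comm_m[OF that]])
      have "p dvd (fdiff c ^^ r' c) (\<lambda>z. fdiff b F (m z)) z" if "c \<in> B" for c z
      proof (cases "c = b")
        case True
        obtain n where "r b = Suc n" using False comp.hyps(1) not0_implies_Suc by blast
        then have "(fdiff b ^^ r' b) (fdiff b F) = (fdiff b ^^ r b) F"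
          by (simp add: r'_def funpow_swap1)
        with Cons.prems(2)[OF comp.hyps(1)] show ?thesis
          by (simp add: shift comp.hyps(1) True)
      next
        case c: False
        have "(fdiff c ^^ r' c) (fdiff b F) = fdiff b ((fdiff c ^^ r c) F)"
          using c by (simp add: r'_def fdiff_funpow_commute comm that comp.hyps(1))
        with Cons.prems(2)[OF that] show ?thesis
          unfolding shift[OF that] by (simp add: fdiff_def[of b])
      qed
      moreover have "sum r' B < length ms + card B"
      proof -
        have "sum r B = r b + sum r (B - {b})" "sum r' B = r' b + sum r' (B - {b})"
          using assms(1) comp.hyps(1) by (simp_all add: sum.remove)
        moreover have "sum r' (B - {b}) = sum r (B - {b})"
          by (rule sum.cong) (auto simp: r'_def)
        moreover have "r b \<noteq> 0" using False comp.hyps(1) by metis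
        ultimately show ?thesis using Cons.prems(3) by (simp add: r'_def)
      qed
      ultimately have "p dvd fold fdiff ms (\<lambda>z. fdiff b F (m z)) z" for z
        using Cons.prems(1) by (intro Cons.IH) auto
      with comp.IH show ?case unfolding fdiff_comp fold_fdiff_add by (intro dvd_add)
    qed
    with Cons.prems(1) show ?thesis by simp
  qed
qed

section \<open>Binomial expansion of (T - 1)^n and its reduction modulo p\<close>

lemma fdiff_funpow_eq_sum:
  "(fdiff \<phi> ^^ n) F z = (\<Sum>k\<le>n. (-1) ^ (n - k) * int (n choose k) * F ((\<phi> ^^ k) z))"
proof (induction n arbitrary: z)
  case (Suc n)
  let ?f = "\<lambda>n k. (-1) ^ (n - k) * int (n choose k) * F ((\<phi> ^^ k) z)"
  have "(fdiff \<phi> ^^ Suc n) F z = (fdiff \<phi> ^^ n) F (\<phi> z) - (fdiff \<phi> ^^ n) F z"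
    by (simp add: fdiff_def)
  also have "\<dots> = (\<Sum>k\<le>n. (-1) ^ (n - k) * int (n choose k) * F ((\<phi> ^^ Suc k) z)) - (\<Sum>k\<le>n. ?f n k)"
    by (simp add: Suc funpow_swap1)
  \<comment> \<open>The added term has binomial coefficient 0; it allows the index shift that
    prepares Pascal's rule.\<close>
  also have "(\<Sum>k\<le>n. ?f n k) = (\<Sum>k\<le>Suc n. ?f n k)" by simp
  also have "\<dots> = (-1) ^ n * F z + (\<Sum>k\<le>n. ?f n (Suc k))"
    by (subst sum.atMost_Suc_shift) simp
  also have "(\<Sum>k\<le>n. (-1) ^ (n - k) * int (n choose k) * F ((\<phi> ^^ Suc k) z)) -
      ((-1) ^ n * F z + (\<Sum>k\<le>n. ?f n (Suc k))) =
      (-1) ^ Suc n * F z + (\<Sum>k\<le>n. (-1) ^ (n - k) * int (n choose k) * F ((\<phi> ^^ Suc k) z) - ?f n (Suc k))"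
    by (simp add: sum_subtractf)
  also have "(\<Sum>k\<le>n. (-1) ^ (n - k) * int (n choose k) * F ((\<phi> ^^ Suc k) z) - ?f n (Suc k)) =
      (\<Sum>k\<le>n. ?f (Suc n) (Suc k))"
  proof (rule sum.cong)
    fix k assume k: "k \<in> {..n}"
    show "(-1) ^ (n - k) * int (n choose k) * F ((\<phi> ^^ Suc k) z) - ?f n (Suc k) = ?f (Suc n) (Suc k)"
    proof (cases "k = n")
      case False
      with k have "n - k = Suc (n - Suc k)" by auto
      then show ?thesis by (simp add: algebra_simps)
    qed simp
  qed simp
  also have "(-1) ^ Suc n * F z + (\<Sum>k\<le>n. ?f (Suc n) (Suc k)) = (\<Sum>k\<le>Suc n. ?f (Suc n) k)"
    by (subst sum.atMost_Suc_shift) simp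
  finally show ?case .
qed simp

text \<open>Otherwise p^e would be coprime to the binomial coefficient, and the absorption identity
  would force p^e to divide k.\<close>

lemma prime_dvd_choose_prime_power:
  fixes p :: nat
  assumes "prime p" "0 < k" "k < p ^ e"
  shows "p dvd (p ^ e choose k)"
proof (rule ccontr)
  assume "\<not> ?thesis"
  then have "coprime (p ^ e) (p ^ e choose k)"
    using assms(1) prime_imp_coprime coprime_power_left_iff by blast
  moreover have "k * (p ^ e choose k) = p ^ e * ((p ^ e - 1) choose (k - 1))"
    using assms(2) by (simp add: times_binomial_minus1_eq)
  then have "p ^ e dvd k * (p ^ e choose k)" by simp
  ultimately have "p ^ e dvd k" by (simp add: coprime_dvd_mult_left_iff)
  with assms show False by (simp add: nat_dvd_not_less)
qed

text \<open>Frobenius: (T - 1)^q and T^q - 1 agree modulo p, since p divides the inner binomial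
  coefficients.\<close>

lemma fdiff_prime_power_cong:
  assumes "prime p" and q: "q = p ^ e"
  shows "int p dvd (fdiff \<phi> ^^ q) F z - fdiff (\<phi> ^^ q) F z"
proof -
  let ?f = "\<lambda>k. (-1) ^ (q - k) * int (q choose k) * F ((\<phi> ^^ k) z)"
  have "q > 0" using assms prime_gt_0_nat by simp
  then have "{..q} = insert 0 (insert q {0<..<q})" by auto
  then have "(fdiff \<phi> ^^ q) F z = (-1) ^ q * F z + F ((\<phi> ^^ q) z) + (\<Sum>k\<in>{0<..<q}. ?f k)"
    using \<open>q > 0\<close> by (simp add: fdiff_funpow_eq_sum)
  then have "(fdiff \<phi> ^^ q) F z - fdiff (\<phi> ^^ q) F z = ((-1) ^ q + 1) * F z + (\<Sum>k\<in>{0<..<q}. ?f k)"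
    by (simp add: fdiff_def algebra_simps)
  \<comment> \<open>The constant terms (-1)^q and -1 coincide for odd q; for even q they differ by
    2, which is p.\<close>
  moreover have "int p dvd (-1) ^ q + 1"
  proof (cases "odd q")
    case False
    then have "even p" using q by simp
    then have "p = 2" using assms(1) primes_dvd_imp_eq two_is_prime_nat by blast
    with False show ?thesis by simp
  qed simp
  moreover have "int p dvd (\<Sum>k\<in>{0<..<q}. ?f k)"
    using prime_dvd_choose_prime_power[OF assms(1)] q
    by (intro dvd_sum) (simp add: dvd_mult dvd_mult2)
  ultimately show ?thesis by simp
qed

text \<open>The c-th power of the Frobenius congruence: each induction step applies it once and the
  induction hypothesis at two points.\<close>

lemma fdiff_prime_power_funpow_cong:
  assumes "prime p" and q: "q = p ^ e"
  shows "int p dvd (fdiff \<phi> ^^ (c * q)) F z - (fdiff (\<phi> ^^ q) ^^ c) F z"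
proof (induction c arbitrary: z)
  case (Suc c)
  let ?A = "(fdiff \<phi> ^^ (c * q)) F" and ?B = "(fdiff (\<phi> ^^ q) ^^ c) F"
  have "(fdiff \<phi> ^^ (Suc c * q)) F z - (fdiff (\<phi> ^^ q) ^^ Suc c) F z =
      ((fdiff \<phi> ^^ q) ?A z - fdiff (\<phi> ^^ q) ?A z) +
      ((?A ((\<phi> ^^ q) z) - ?B ((\<phi> ^^ q) z)) - (?A z - ?B z))"
    by (simp add: funpow_add) (simp add: fdiff_def[of "\<phi> ^^ q"])
  also have "int p dvd \<dots>"
    by (intro dvd_add dvd_diff Suc fdiff_prime_power_cong[OF assms])
  finally show ?case .
qed simp

section \<open>Polynomials as functions annihilated by iterated differences\<close>

text \<open>Annihilation by the n-th difference encodes degree less than n, and a linear factor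
  raises the degree by at most one. The discrete Leibniz rule replaces b by b - 1, so the induction
  is for all b.\<close>

lemma fdiff_linear_factor:
  assumes "(fdiff Suc ^^ n) P = (\<lambda>_. 0)"
  shows "(fdiff Suc ^^ Suc n) (\<lambda>j. P j * (int j - b)) = (\<lambda>_. 0)"
  using assms
proof (induction n arbitrary: P b)
  case 0
  then show ?case by (simp add: fdiff_def)
next
  case (Suc n)
  have eq: "fdiff Suc (\<lambda>j. P j * (int j - b)) = (\<lambda>j. fdiff Suc P j * (int j - (b - 1)) + P j)"
    by (simp add: fdiff_def fun_eq_iff algebra_simps)
  have add: "(fdiff Suc ^^ m) (\<lambda>j. F j + H j) = (\<lambda>j. (fdiff Suc ^^ m) F j + (fdiff Suc ^^ m) H j)" for m F H
    by (induction m) (simp_all add: fdiff_def fun_eq_iff)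
  have "(fdiff Suc ^^ Suc (Suc n)) (\<lambda>j. P j * (int j - b)) =
     (fdiff Suc ^^ Suc n) (fdiff Suc (\<lambda>j. P j * (int j - b)))"
    by (simp only: funpow_Suc_right comp_apply)
  also have "\<dots> = (\<lambda>_. 0)"
    unfolding eq add using Suc.IH[of "fdiff Suc P" "b - 1"] Suc.prems
    by (simp only: funpow_Suc_right comp_apply) simp
  finally show ?case .
qed

lemma fdiff_prod_linear:
  assumes "finite K" "card K < n"
  shows "(fdiff Suc ^^ n) (\<lambda>j. \<Prod>b\<in>K. int j - int b) = (\<lambda>_. 0)"
  using assms
proof (induction K arbitrary: n rule: finite_induct)
  case empty
  then obtain m where "n = Suc m" by (auto simp: gr0_conv_Suc)
  moreover have "(fdiff Suc ^^ m) (\<lambda>_. 0) = (\<lambda>_. 0)"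
    by (induction m) (simp_all add: fdiff_def)
  ultimately show ?case 
    by (simp add: funpow_Suc_right del: funpow.simps) (simp add: fdiff_def[of Suc "\<lambda>_. 1"])
next
  case (insert b K)
  then obtain m where "n = Suc m" "card K < m" by (cases n) auto
  with fdiff_linear_factor[of m _ "int b", OF insert.IH] insert.hyps show ?case
    by (simp add: mult.commute)
qed

subsection \<open>Bases of finite abelian $p$-groups\<close>

context comm_group begin

section \<open>Sums of sequences\<close>

lemma seq_sum_closed [simp]: "seq_over G S \<Longrightarrow> seq_sum G S \<in> carrier G"
  by (auto simp: seq_sum_def seq_over_def intro!: finprod_closed)

lemma seq_sum_eq_finprod:
  assumes "finite X" "set_mset S \<subseteq> X" "X \<subseteq> carrier G"
  shows "seq_sum G S = (\<Otimes>x\<in>X. x [^] count S x)"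
  unfolding seq_sum_def
  using assms by (intro finprod_mono_neutral_cong_left) (auto simp: not_in_iff)

lemma seq_sum_union:
  assumes "seq_over G S" "seq_over G T"
  shows "seq_sum G (S + T) = seq_sum G S \<otimes> seq_sum G T"
proof -
  let ?X = "set_mset S \<union> set_mset T"
  have X: "finite ?X" "?X \<subseteq> carrier G" using assms by (auto simp: seq_over_def)
  have "seq_sum G (S + T) = (\<Otimes>x\<in>?X. x [^] count S x \<otimes> x [^] count T x)"
    using X by (subst seq_sum_eq_finprod[of ?X]) (auto intro!: finprod_cong' simp: nat_pow_mult)
  also have "\<dots> = seq_sum G S \<otimes> seq_sum G T"
    using X seq_sum_eq_finprod[of ?X S] seq_sum_eq_finprod[of ?X T]
    by (subst finprod_multf) auto
  finally show ?thesis .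
qed

lemma seq_sum_add_mset:
  assumes "g \<in> carrier G" "seq_over G T"
  shows "seq_sum G (add_mset g T) = g \<otimes> seq_sum G T"
proof -
  have "seq_sum G {#g#} = g" using assms(1) by (simp add: seq_sum_def)
  with seq_sum_union[of "{#g#}" T] assms show ?thesis by (simp add: seq_over_def)
qed

lemma seq_sum_empty [simp]: "seq_sum G {#} = \<one>"
  by (simp add: seq_sum_def)

lemma seq_over_subset: "seq_over G S \<Longrightarrow> T \<subseteq># S \<Longrightarrow> seq_over G T"
  by (auto simp: seq_over_def dest: mset_subset_eqD)

section \<open>Independent generating sets\<close>

text \<open>Natural exponents lose nothing in a finite group, where inverses are powers. The
  identity may belong to X: its order 1 divides every exponent.\<close>

definition indep :: "'a set \<Rightarrow> bool" where
  "indep X \<longleftrightarrow> (\<forall>a::'a \<Rightarrow> nat. (\<Otimes>x\<in>X. x [^] a x) = \<one> \<longrightarrow> (\<forall>x\<in>X. ord x dvd a x))"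

lemma finprod_pow:
  assumes "finite X" "f \<in> X \<rightarrow> carrier G"
  shows "(\<Otimes>x\<in>X. f x) [^] (n::nat) = (\<Otimes>x\<in>X. f x [^] n)"
  using assms by (induction X rule: finite_induct) (auto simp: nat_pow_distrib Pi_def)

lemma generate_nat_pow_closed:
  assumes "H \<subseteq> carrier G" "h \<in> generate G H"
  shows "h [^] (n::nat) \<in> generate G H"
  using assms(2) by (induction n) (auto intro: generate.one generate.eng)

lemma pow_mod_ord: "x \<in> carrier G \<Longrightarrow> x [^] (n mod ord x) = x [^] (n::nat)"
  by (metis l_one mult_div_mod_eq nat_pow_closed nat_pow_mult nat_pow_one nat_pow_pow pow_ord_eq_1)

lemma finprod_in_generate:
  assumes "finite X" "X \<subseteq> H" "H \<subseteq> carrier G"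
  shows "(\<Otimes>x\<in>X. x [^] (a x :: nat)) \<in> generate G H"
proof -
  interpret H: subgroup "generate G H" G by (rule generate_is_subgroup[OF assms(3)])
  show ?thesis
    using assms(1,2)
  proof (induction X rule: finite_induct)
    case (insert x X)
    have "x [^] a x \<in> generate G H"
      using insert.prems generate.incl[of x H G] generate_nat_pow_closed assms(3) by blast
    then show ?case using insert assms(3)
      by (subst finprod_insert) (auto intro!: H.m_closed)
  qed simp
qed

text \<open>Since y is j^(b j) times a product of powers of the other generators, the new set
  generates j^(b j); as b j is invertible modulo the order of j, it generates j.\<close>

lemma replace_generator:
  assumes "finite (carrier G)" and X: "finite X" "X \<subseteq> carrier G" "generate G X = carrier G"
    and j: "j \<in> X" and cop: "coprime (b j) (ord j)"
    and y: "y = (\<Otimes>x\<in>X. x [^] (b x :: nat))"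
  shows "generate G (insert y (X - {j})) = carrier G"
proof -
  let ?Y = "insert y (X - {j})"
  have jc: "j \<in> carrier G" using j X by auto
  have yc: "y \<in> carrier G" unfolding y using X(2) by (auto intro!: finprod_closed)
  then have Yc: "?Y \<subseteq> carrier G" using X(2) by auto
  interpret H: subgroup "generate G ?Y" G by (rule generate_is_subgroup[OF Yc])
  let ?z = "\<Otimes>x\<in>X - {j}. x [^] b x"
  have zc: "?z \<in> carrier G" using X(2) by (auto intro!: finprod_closed)
  have "y = j [^] b j \<otimes> ?z"
    unfolding y using X j jc finprod_insert[of "X - {j}" j "\<lambda>x. x [^] b x"]
    by (auto simp: insert_absorb)
  then have "j [^] b j = y \<otimes> inv ?z"
    using jc zc by (simp add: m_assoc)
  moreover have "?z \<in> generate G ?Y"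
    using X(1) Yc by (intro finprod_in_generate) auto
  moreover have "y \<in> generate G ?Y" by (simp add: generate.incl)
  ultimately have "j [^] b j \<in> generate G ?Y" by simp
  then have pow: "(j [^] b j) [^] (t::nat) \<in> generate G ?Y" for t
    by (rule generate_nat_pow_closed[OF Yc])
  obtain t where t: "[b j * t = 1] (mod ord j)"
    using cong_solve_coprime_nat[OF cop] by auto
  have "(j [^] b j) [^] t = j"
  proof -
    have "(j [^] b j) [^] t = j [^] (b j * t)" using jc by (simp add: nat_pow_pow)
    also have "\<dots> = j [^] (1::nat)"
      using t jc by (metis cong_def pow_mod_ord)
    finally show ?thesis using jc by simp
  qed
  with pow[of t] have "j \<in> generate G ?Y" by simp
  then have "X \<subseteq> generate G ?Y" by (auto intro: generate.incl)
  then have "generate G X \<subseteq> generate G ?Y"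
    using generate_is_subgroup[OF Yc] by (rule generate_subgroup_incl)
  with X(3) generate_incl[OF Yc] show ?thesis by auto
qed

text \<open>A generating set with the least possible sum of orders is independent: in a relation
  $\prod_x x^{p^s b_x} = 1$ with $p \nmid b_j$, the generator $j$ could be replaced by
  $\prod_x x^{b_x}$, whose order divides $p^s$.\<close>

lemma exists_basis:
  assumes "prime p" and fin: "finite (carrier G)" and ordG: "order G = p ^ n"
  obtains X where "X \<subseteq> carrier G" "generate G X = carrier G" "indep X"
proof -
  define P where "P X \<longleftrightarrow> X \<subseteq> carrier G \<and> generate G X = carrier G" for X
  have "P (carrier G)" using generate_incl[of "carrier G"] generate.incl[of _ "carrier G" G]
    by (auto simp: P_def)
  then obtain X where X: "P X" and min: "\<And>Y. P Y \<Longrightarrow> (\<Sum>x\<in>X. ord x) \<le> (\<Sum>x\<in>Y. ord x)"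
    using ex_has_least_nat[of P "carrier G" "\<lambda>X. \<Sum>x\<in>X. ord x"] by blast
  have Xc: "X \<subseteq> carrier G" and finX: "finite X" and gen: "generate G X = carrier G"
    using X fin finite_subset by (auto simp: P_def)
  have "indep X"
    unfolding indep_def
  proof (intro allI impI, rule ccontr)
    fix a :: "'a \<Rightarrow> nat"
    assume rel: "(\<Otimes>x\<in>X. x [^] a x) = \<one>" and "\<not> (\<forall>x\<in>X. ord x dvd a x)"
    then obtain x0 where x0: "x0 \<in> X" "\<not> ord x0 dvd a x0" by auto
    \<comment> \<open>Reduced exponents keep the relation, stay below the orders and are not all
      0.\<close>
    define a' where "a' x = a x mod ord x" for x
    have rel': "(\<Otimes>x\<in>X. x [^] a' x) = \<one>"
      unfolding rel[symmetric] using Xc by (intro finprod_cong') (auto simp: a'_def pow_mod_ord)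
    define N where "N = {x \<in> X. a' x \<noteq> 0}"
    have "x0 \<in> N" using x0 by (auto simp: N_def a'_def mod_eq_0_iff_dvd)
    \<comment> \<open>Minimal p-adic valuation at j lets p^s be divided out of all exponents,
      leaving one at j that is prime to p.\<close>
    then obtain j where j: "j \<in> N" and jmin: "\<And>x. x \<in> N \<Longrightarrow> multiplicity p (a' j) \<le> multiplicity p (a' x)"
      using ex_has_least_nat[of "\<lambda>x. x \<in> N" x0 "\<lambda>x. multiplicity p (a' x)"] by blast
    define s where "s = multiplicity p (a' j)"
    have dvd: "p ^ s dvd a' x" if "x \<in> X" for x
      using jmin[of x] that by (cases "a' x = 0") (auto simp: N_def s_def intro: multiplicity_dvd')
    define b where "b x = a' x div p ^ s" for x
    have a'_eq: "a' x = b x * p ^ s" if "x \<in> X" for x using dvd[OF that] by (simp add: b_def)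
    have jX: "j \<in> X" and jc: "j \<in> carrier G" and a'j: "a' j > 0" using j Xc by (auto simp: N_def)
    have "\<not> p dvd b j"
      using a'j assms(1) multiplicity_decompose[of "a' j" p] prime_gt_1_nat[of p] by (simp add: b_def s_def)
    moreover have "ord j dvd p ^ n" using ord_dvd_group_order[OF jc] ordG by simp
    then obtain i where "ord j = p ^ i" using assms(1) divides_primepow_nat by blast
    ultimately have cop: "coprime (b j) (ord j)"
      using assms(1) by (simp add: prime_imp_coprime coprime_commute)
    define y where "y = (\<Otimes>x\<in>X. x [^] b x)"
    have yc: "y \<in> carrier G" unfolding y_def using Xc by (auto intro!: finprod_closed)
    have "y [^] (p ^ s) = (\<Otimes>x\<in>X. (x [^] b x) [^] (p ^ s))"
      unfolding y_def using finX Xc by (intro finprod_pow) auto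
    also have "\<dots> = (\<Otimes>x\<in>X. x [^] a' x)"
      using Xc by (intro finprod_cong') (auto simp: nat_pow_pow a'_eq)
    finally have "ord y dvd p ^ s" using rel' yc by (simp add: pow_eq_id)
    then have "ord y \<le> p ^ s" using assms(1) by (simp add: dvd_imp_le prime_gt_0_nat)
    also have "\<dots> \<le> a' j" using dvd[OF jX] a'j by (simp add: dvd_imp_le)
    also have "\<dots> < ord j" using ord_ge_1[OF fin jc] by (simp add: a'_def)
    finally have less: "ord y < ord j" .
    have "P (insert y (X - {j}))"
      using replace_generator[OF fin finX Xc gen jX cop y_def] Xc yc by (auto simp: P_def)
    from min[OF this] have "(\<Sum>x\<in>X. ord x) \<le> (\<Sum>x\<in>insert y (X - {j}). ord x)" .
    \<comment> \<open>Only an inequality, as y may already lie in X - {j}.\<close>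
    also have "\<dots> \<le> ord y + (\<Sum>x\<in>X - {j}. ord x)" using finX by (simp add: sum.insert_if)
    also have "\<dots> < ord j + (\<Sum>x\<in>X - {j}. ord x)" using less by simp
    also have "\<dots> = (\<Sum>x\<in>X. ord x)" using finX jX by (simp add: sum.remove)
    finally show False by simp
  qed
  with Xc gen show ?thesis by (rule that)
qed

text \<open>Independence forces the order of x to divide its multiplicity in T, which is smaller
  than that order.\<close>

lemma indep_zero_sum_free:
  assumes fin: "finite (carrier G)" and X: "X \<subseteq> carrier G" "indep X"
    and T: "T \<subseteq># (\<Sum>x\<in>X. replicate_mset (ord x - 1) x)" "zero_sum G T"
  shows "T = {#}"
proof -
  have finX: "finite X" using fin X finite_subset by blast
  have count: "count (\<Sum>x\<in>X. replicate_mset (ord x - 1) x) y = (if y \<in> X then ord y - 1 else 0)" for y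
    using finX by (simp add: count_sum)
  have le: "count T y \<le> (if y \<in> X then ord y - 1 else 0)" for y
    using mset_subset_eq_count[OF T(1), of y] by (simp only: count)
  have sub: "set_mset T \<subseteq> X"
  proof
    fix y assume "y \<in># T"
    then have "count T y \<noteq> 0" by (metis not_in_iff)
    with le[of y] show "y \<in> X" by (metis le_zero_eq)
  qed
  with T(2) have "(\<Otimes>x\<in>X. x [^] count T x) = \<one>"
    using seq_sum_eq_finprod[OF finX sub X(1)] by (simp add: zero_sum_def)
  with X(2) have dvd: "ord x dvd count T x" if "x \<in> X" for x
    using that by (simp add: indep_def)
  have "count T x = 0" for x
  proof (cases "x \<in> X")
    case True
    then have "ord x \<ge> 1" using X ord_ge_1[OF fin] by auto
    with le[of x] True have "count T x < ord x" by simp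
    with dvd[OF True] show ?thesis using nat_dvd_not_less by blast
  next
    case False
    with le[of x] show ?thesis by simp
  qed
  then show ?thesis by (simp add: multiset_eq_iff)
qed

end

subsection \<open>Zero-sum subsequences of prescribed lengths\<close>

text \<open>A pair (x, l) records a sum together with its length. Lengths are natural numbers rather
  than residues modulo q, so that a polynomial in l/q can be evaluated.\<close>

definition lshift :: "'a \<times> nat \<Rightarrow> 'a \<times> nat" where
  "lshift = (\<lambda>(x, l). (x, Suc l))"

lemma lshift_funpow: "(lshift ^^ n) (x, l) = (x, l + n)"
  by (induction n) (simp_all add: lshift_def)

lemma ex_submset_of_size:
  assumes "n \<le> size S"
  obtains T where "T \<subseteq># S" "size T = n"
proof -
  obtain xs where "mset xs = S" using ex_mset by blast
  moreover have "mset xs = mset (take n xs) + mset (drop n xs)"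
    by (metis append_take_drop_id mset_append)
  then have "mset (take n xs) \<subseteq># mset xs" by simp
  ultimately show ?thesis using assms that[of "mset (take n xs)"] by auto
qed

context comm_group begin

text \<open>Extended by the identity outside the carrier, so that \<open>gshift\<close> is a homomorphism into the
  functions on the whole type.\<close>

definition gshift :: "'a \<Rightarrow> 'a \<times> nat \<Rightarrow> 'a \<times> nat" where
  "gshift g = (\<lambda>(x, l). (if x \<in> carrier G then g \<otimes> x else x, l))"

definition level :: "nat \<Rightarrow> (nat \<Rightarrow> int) \<Rightarrow> 'a \<times> nat \<Rightarrow> int" where
  "level q P = (\<lambda>(x, l). if x = \<one> \<and> q dvd l then P (l div q) else 0)"

lemma gshift_mult:
  "g \<in> carrier G \<Longrightarrow> h \<in> carrier G \<Longrightarrow> gshift (g \<otimes> h) = gshift g \<circ> gshift h"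
  by (auto simp: gshift_def fun_eq_iff m_assoc)

lemma gshift_one: "gshift \<one> = id"
  by (auto simp: gshift_def fun_eq_iff)

lemma gshift_pow: "g \<in> carrier G \<Longrightarrow> gshift (g [^] n) = gshift g ^^ n" for n :: nat
proof (induction n)
  case (Suc n)
  then have "gshift (g \<otimes> g [^] n) = gshift g ^^ Suc n" by (simp add: gshift_mult)
  then show ?case using Suc.prems by (simp add: m_comm)
qed (simp add: gshift_one)

lemma gshift_commute:
  "g \<in> carrier G \<Longrightarrow> h \<in> carrier G \<Longrightarrow> gshift g \<circ> gshift h = gshift h \<circ> gshift g"
  using gshift_mult[of g h] gshift_mult[of h g] by (simp add: m_comm)

lemma gshift_lshift_commute: "gshift g \<circ> lshift = lshift \<circ> gshift g"
  by (auto simp: gshift_def lshift_def fun_eq_iff)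

text \<open>Compositions contain no inverses, but in a finite group the inverse of h is a power of
  h.\<close>

lemma gshift_in_comp_closure:
  assumes fin: "finite (carrier G)" and X: "X \<subseteq> carrier G" "gshift ` X \<subseteq> B"
    and "g \<in> generate G X"
  shows "gshift g \<in> comp_closure B"
  using assms(4)
proof induction
  case one
  show ?case unfolding gshift_one by (rule comp_closure.id)
next
  case (incl h)
  then show ?case using X(2) by (auto intro: comp_closure_incl)
next
  case (inv h)
  then have hc: "h \<in> carrier G" using X(1) by auto
  then obtain n where n: "ord h = Suc n" using ord_ge_1[OF fin] by (metis Suc_le_D One_nat_def)
  then have "h [^] n \<otimes> h = \<one>" using pow_ord_eq_1[OF hc] by simp
  then have "inv h = h [^] n" using hc by (simp add: inv_equality)
  moreover have "gshift h \<in> comp_closure B" using inv X(2) by (auto intro: comp_closure_incl)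
  ultimately show ?case using hc by (simp add: gshift_pow comp_closure_funpow)
next
  case (eng g h)
  then have "gshift (g \<otimes> h) = gshift g \<circ> gshift h"
    using generate_in_carrier[OF X(1)] by (intro gshift_mult) auto
  then show ?case using eng by (simp only: comp_closure_comp)
qed

text \<open>Adding q to the length preserves divisibility by q and raises the quotient by
  one.\<close>

lemma fdiff_level:
  assumes "q > 0"
  shows "fdiff (lshift ^^ q) (level q P) = level q (fdiff Suc P)"
  using assms by (auto simp: fdiff_def level_def fun_eq_iff lshift_funpow)

text \<open>Expanding the product of the factors g - 1 gives a signed sum of F over all
  subsequences, of which only the empty one contributes.\<close>

lemma fold_fdiff_eval:
  assumes "set xs \<subseteq> carrier G"
    and "\<And>T. T \<subseteq># mset xs \<Longrightarrow> T \<noteq> {#} \<Longrightarrow> F (seq_sum G T, size T) = 0"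
  shows "fold fdiff (map (\<lambda>g. gshift g \<circ> lshift) xs) F (\<one>, 0) = (-1) ^ length xs * F (\<one>, 0)"
  using assms
proof (induction xs arbitrary: F)
  case (Cons g xs)
  let ?F = "fdiff (gshift g \<circ> lshift) F"
  have g: "g \<in> carrier G" and xs: "seq_over G (mset xs)" using Cons.prems(1) by (auto simp: seq_over_def)
  \<comment> \<open>One difference yields the value at T with g added, which is 0, minus the value
    at T. So the hypothesis on F passes to \<open>?F\<close>.\<close>
  have eval: "?F (seq_sum G T, size T) = - F (seq_sum G T, size T)" if "T \<subseteq># mset xs" for T
  proof -
    have "seq_over G T" using seq_over_subset[OF xs that] .
    then have "?F (seq_sum G T, size T) =
        F (seq_sum G (add_mset g T), size (add_mset g T)) - F (seq_sum G T, size T)"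
      using g by (simp add: fdiff_def gshift_def lshift_def seq_sum_add_mset)
    moreover have "add_mset g T \<subseteq># mset (g # xs)" using that by simp
    ultimately show ?thesis using Cons.prems(2)[of "add_mset g T"] by simp
  qed
  have "?F (seq_sum G T, size T) = 0" if "T \<subseteq># mset xs" "T \<noteq> {#}" for T
  proof -
    have "T \<subseteq># mset (g # xs)" using that(1) by (simp add: subset_mset.order_trans[OF that(1)])
    then show ?thesis using eval[OF that(1)] Cons.prems(2)[of T] that(2) by simp
  qed
  then have "fold fdiff (map (\<lambda>g. gshift g \<circ> lshift) xs) ?F (\<one>, 0) = (-1) ^ length xs * ?F (\<one>, 0)"
    using Cons.prems(1) by (intro Cons.IH) auto
  also have "?F (\<one>, 0) = - F (\<one>, 0)" using eval[of "{#}"] by simp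
  finally show ?case by simp
qed simp

text \<open>Without such T, the product of differences of \<open>level q P\<close> at the origin
  would be P 0 up to sign. But it vanishes modulo p: the exponents are the orders of the generators
  and cq for the length, and there are too many factors.\<close>

lemma weighted_zero_sum:
  assumes "prime p" and q: "q = p ^ e" and fin: "finite (carrier G)" and ordG: "order G = p ^ n"
    and X: "X \<subseteq> carrier G" "generate G X = carrier G"
    and xs: "set xs \<subseteq> carrier G" and P: "(fdiff Suc ^^ c) P = (\<lambda>_. 0)" "\<not> int p dvd P 0"
    and len: "(\<Sum>x\<in>X. ord x - 1) + c * q \<le> length xs"
  shows "\<exists>T. T \<subseteq># mset xs \<and> T \<noteq> {#} \<and> zero_sum G T \<and> q dvd size T \<and> P (size T div q) \<noteq> 0"
proof (rule ccontr)
  assume contra: "\<not> ?thesis"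
  have q0: "q > 0" using q assms(1) by (simp add: prime_gt_0_nat)
  have finX: "finite X" using X(1) fin finite_subset by blast
  define B where "B = insert lshift (gshift ` X)"
  \<comment> \<open>Exponents are indexed by operators, so the generator x is recovered from
    \<open>gshift x\<close> by evaluating at the origin.\<close>
  define r where "r \<phi> = (if \<phi> = lshift then c * q else ord (fst (\<phi> (\<one>, 0))))" for \<phi> :: "'a \<times> nat \<Rightarrow> 'a \<times> nat"
  let ?F = "level q P" and ?ms = "map (\<lambda>g. gshift g \<circ> lshift) xs"
  have fst_gshift: "fst (gshift x (\<one>, 0)) = x" if "x \<in> X" for x
    using that X(1) by (auto simp: gshift_def)
  then have inj: "inj_on gshift X" by (metis inj_onI)
  have notin: "lshift \<noteq> gshift x" for x
  proof
    assume "lshift = gshift x"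
    then have "lshift (\<one>, 0) = gshift x (\<one>, 0)" by simp
    then show False by (simp add: lshift_def gshift_def)
  qed
  have r_gshift: "r (gshift x) = ord x" if "x \<in> X" for x
    using that notin[of x] fst_gshift by (simp add: r_def)
  have r_lshift: "r lshift = c * q" by (simp add: r_def)
  have "int p dvd fold fdiff ?ms ?F (\<one>, 0)"
  proof (rule dvd_fold_fdiff)
    show "finite B" using finX by (simp add: B_def)
    show "a \<circ> b = b \<circ> a" if "a \<in> B" "b \<in> B" for a b
      using that gshift_commute[OF subsetD[OF X(1)] subsetD[OF X(1)]] gshift_lshift_commute by (auto simp: B_def subset_iff simp del: o_apply)
    show "set ?ms \<subseteq> comp_closure B"
    proof -
      have "gshift g \<circ> lshift \<in> comp_closure B" if "g \<in> set xs" for g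
      proof (intro comp_closure_comp)
        show "gshift g \<in> comp_closure B"
          using xs that X by (intro gshift_in_comp_closure[OF fin X(1)]) (auto simp: B_def)
      qed (simp add: B_def comp_closure_incl)
      then show ?thesis by auto
    qed
    show "int p dvd (fdiff b ^^ r b) ?F z" if "b \<in> B" for b z
    proof (cases "b = lshift")
      case True
      \<comment> \<open>Modulo p, (T - 1)^(cq) is (T^q - 1)^c, which acts as the c-th difference on
        P and hence gives 0.\<close>
      have "(fdiff (lshift ^^ q) ^^ m) (level q P) = level q ((fdiff Suc ^^ m) P)" for m
        by (induction m) (simp_all add: fdiff_level q0)
      then have "(fdiff (lshift ^^ q) ^^ c) ?F z = 0" by (simp add: P(1) level_def split: prod.split)
      then show ?thesis
        using fdiff_prime_power_funpow_cong[OF assms(1) q, where \<phi> = lshift and c = c and F = ?F and z = z] True by (simp add: r_lshift)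
    next
      case False
      then obtain x where x: "x \<in> X" "b = gshift x" using \<open>b \<in> B\<close> by (auto simp: B_def)
      then have xc: "x \<in> carrier G" using X(1) by auto
      have "ord x dvd p ^ n" using ord_dvd_group_order[OF xc] ordG by simp
      then obtain i where i: "ord x = p ^ i" using assms(1) divides_primepow_nat by blast
      \<comment> \<open>The order of x is a power of p, so Frobenius turns this power of T - 1 into
        T^(ord x) - 1 = 0.\<close>
      have "gshift x ^^ ord x = id" using xc by (simp add: gshift_pow[symmetric] gshift_one)
      then have "fdiff (b ^^ ord x) ?F z = 0" by (simp add: x(2) fdiff_def)
      with fdiff_prime_power_cong[OF assms(1) i, where \<phi> = b and F = ?F and z = z] show ?thesis
        using x by (simp add: r_gshift)
    qed
    have "ord x = (ord x - 1) + 1" if "x \<in> X" for x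
      using ord_ge_1[OF fin, of x] X(1) that by fastforce
    then have "(\<Sum>x\<in>X. ord x) = (\<Sum>x\<in>X. (ord x - 1) + 1)" by (rule sum.cong[OF refl])
    also have "\<dots> = (\<Sum>x\<in>X. ord x - 1) + card X" by (simp only: sum.distrib) simp
    finally have "sum r (gshift ` X) = (\<Sum>x\<in>X. ord x - 1) + card X"
      using inj by (simp add: sum.reindex r_gshift)
    moreover have "lshift \<notin> gshift ` X" using notin by auto
    ultimately show "sum r B < length ?ms + card B"
      using len finX inj by (simp add: B_def r_lshift card_image)
  qed
  also have "fold fdiff ?ms ?F (\<one>, 0) = (-1) ^ length xs * ?F (\<one>, 0)"
    using contra by (intro fold_fdiff_eval xs) (auto simp: level_def zero_sum_def)
  also have "?F (\<one>, 0) = P 0" by (simp add: level_def)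
  finally have "int p dvd P 0" by (cases "even (length xs)") auto
  with P(2) show False by simp
qed

section \<open>The Davenport constant of a finite abelian p-group\<close>

text \<open>The least element in the definition exists because Olson's upper bound 1 + \<Sum>(ord x
  - 1) over a basis is an admissible length.\<close>

lemma davenport_property:
  assumes "prime p" and fin: "finite (carrier G)" and ordG: "order G = p ^ n"
  shows "davenport G > 0"
    and "seq_over G S \<Longrightarrow> size S = davenport G \<Longrightarrow> \<exists>T. T \<subseteq># S \<and> T \<noteq> {#} \<and> zero_sum G T"
proof -
  obtain X where X: "X \<subseteq> carrier G" "generate G X = carrier G" "indep X"
    using exists_basis[OF assms] .
  let ?Q = "\<lambda>l. l > 0 \<and> (\<forall>S. seq_over G S \<and> size S = l \<longrightarrow> (\<exists>T. T \<subseteq># S \<and> T \<noteq> {#} \<and> zero_sum G T))"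
  have "?Q (Suc (\<Sum>x\<in>X. ord x - 1))"
  proof (intro conjI allI impI)
    fix S assume S: "seq_over G S \<and> size S = Suc (\<Sum>x\<in>X. ord x - 1)"
    obtain xs where xs: "mset xs = S" using ex_mset by blast
    \<comment> \<open>With q = 1, c = 1 and constant weight 1, subsequences of all lengths
      count.\<close>
    have "(fdiff Suc ^^ 1) (\<lambda>_. 1) = (\<lambda>_. 0)" by (simp add: fdiff_def)
    moreover have "\<not> int p dvd 1" using assms(1) by (auto simp: prime_nat_iff)
    ultimately show "\<exists>T. T \<subseteq># S \<and> T \<noteq> {#} \<and> zero_sum G T"
      using weighted_zero_sum[OF assms(1) _ fin ordG X(1,2), of 1 0 xs 1 "\<lambda>_. 1"] S xs
      by (auto simp: seq_over_def)
  qed simp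
  then have "?Q (davenport G)" unfolding davenport_def by (rule LeastI)
  then show "davenport G > 0"
    and "seq_over G S \<Longrightarrow> size S = davenport G \<Longrightarrow> \<exists>T. T \<subseteq># S \<and> T \<noteq> {#} \<and> zero_sum G T" by auto
qed

text \<open>Each basis element x repeated ord x - 1 times gives a zero-sum free sequence, which must
  be shorter than the Davenport constant.\<close>

lemma sum_ord_less_davenport:
  assumes "prime p" and fin: "finite (carrier G)" and ordG: "order G = p ^ n"
    and X: "X \<subseteq> carrier G" "indep X"
  shows "(\<Sum>x\<in>X. ord x - 1) < davenport G"
proof (rule ccontr)
  let ?S = "\<Sum>x\<in>X. replicate_mset (ord x - 1) x"
  assume "\<not> ?thesis"
  moreover have "size ?S = (\<Sum>x\<in>X. ord x - 1)" by (simp add: size_multiset_sum)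
  ultimately have "davenport G \<le> size ?S" by simp
  then obtain S where S: "S \<subseteq># ?S" "size S = davenport G" by (rule ex_submset_of_size)
  have "set_mset ?S \<subseteq> X" using X(1) fin finite_subset[of X]
    by (auto simp: set_mset_sum split: if_splits)
  then have "seq_over G S" using S(1) X(1) by (auto simp: seq_over_def dest: mset_subset_eqD)
  with davenport_property(2)[OF assms(1-3)] S(2) obtain T
    where "T \<subseteq># S" "T \<noteq> {#}" "zero_sum G T" by blast
  with indep_zero_sum_free[OF fin X] S(1) show False by (meson subset_mset.order_trans)
qed

section \<open>Attained multiples of q\<close>

definition attained :: "nat \<Rightarrow> 'a multiset \<Rightarrow> nat \<Rightarrow> bool" where
  "attained q S j \<longleftrightarrow> (\<exists>T. T \<subseteq># S \<and> size T = j * q \<and> zero_sum G T)"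

text \<open>Olson's argument with a polynomial whose roots are the c - 1 unwanted values in the
  range; these lie strictly between 0 and p, so its value at 0 is prime to p.\<close>

lemma attained_if_card_eq:
  assumes "prime p" and q: "q = p ^ e" and fin: "finite (carrier G)" and ordG: "order G = p ^ n"
    and D: "davenport G \<le> d * q" and S: "seq_over G S"
    and size: "davenport G - 1 + c * q \<le> size S" and "c \<ge> 1"
    and A: "A \<subseteq> {1..d + c - 1}" "card A = d" and "d + c \<le> p"
  shows "\<exists>j\<in>A. attained q S j"
proof -
  obtain X where X: "X \<subseteq> carrier G" "generate G X = carrier G" "indep X"
    using exists_basis[OF assms(1) fin ordG] .
  have q0: "q > 0" using q assms(1) by (simp add: prime_gt_0_nat)
  have D0: "davenport G > 0" by (rule davenport_property(1)[OF assms(1) fin ordG])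
  \<comment> \<open>Trimming to this exact length, less than (d + c) q, keeps the attained value
    within the range.\<close>
  obtain S' where S': "S' \<subseteq># S" "size S' = davenport G - 1 + c * q"
    using size by (rule ex_submset_of_size)
  obtain xs where xs: "mset xs = S'" using ex_mset by blast
  define K where "K = {1..d + c - 1} - A"
  define P where "P j = (\<Prod>b\<in>K. int j - int b)" for j :: nat
  have "card K = c - 1" using A assms(8) finite_subset[OF A(1)] by (simp add: K_def card_Diff_subset)
  then have P0: "(fdiff Suc ^^ c) P = (\<lambda>_. 0)"
    unfolding P_def using assms(8) by (intro fdiff_prod_linear) (auto simp: K_def)
  have "\<not> int p dvd P 0"
  proof
    assume "int p dvd P 0"
    then obtain b where b: "b \<in> K" "int p dvd int 0 - int b"
      using assms(1) by (auto simp: P_def prime_dvd_prod_iff K_def)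
    then have "p dvd b" by simp
    moreover have "0 < b" "b < p" using b(1) assms(11) by (auto simp: K_def)
    ultimately show False using nat_dvd_not_less by blast
  qed
  moreover have "set xs \<subseteq> carrier G" using S S'(1) xs by (auto simp: seq_over_def dest: mset_subset_eqD)
  moreover have "(\<Sum>x\<in>X. ord x - 1) + c * q \<le> length xs"
    using sum_ord_less_davenport[OF assms(1) fin ordG X(1,3)] S'(2) xs by auto
  ultimately obtain T where T: "T \<subseteq># mset xs" "T \<noteq> {#}" "zero_sum G T" "q dvd size T" "P (size T div q) \<noteq> 0"
    using weighted_zero_sum[OF assms(1) q fin ordG X(1,2) _ P0] by blast
  obtain j where j: "size T = j * q" using T(4) by (auto simp: dvd_def mult.commute)
  have "j * q < (d + c) * q"
  proof -
    have "size T \<le> size S'" using T(1) xs size_mset_mono by auto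
    then show ?thesis using j S'(2) D D0 by (simp add: algebra_simps)
  qed
  then have "j < d + c" by simp
  moreover have "j \<noteq> 0" using T(2) j by (metis mult_0 size_eq_0_iff_empty)
  moreover have "P j \<noteq> 0" using T(5) j q0 by simp
  then have "j \<notin> K" by (auto simp: P_def K_def)
  ultimately have "j \<in> A" by (auto simp: K_def)
  moreover have "attained q S j"
    using T(1,3) j S'(1) xs by (auto simp: attained_def intro: subset_mset.order_trans)
  ultimately show ?thesis by blast
qed

lemma attained_mono: "attained q T j \<Longrightarrow> T \<subseteq># S \<Longrightarrow> attained q S j"
  unfolding attained_def by (meson subset_mset.order_trans)

lemma zero_sum_union:
  "seq_over G S \<Longrightarrow> seq_over G T \<Longrightarrow> zero_sum G S \<Longrightarrow> zero_sum G T \<Longrightarrow> zero_sum G (S + T)"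
  by (simp add: zero_sum_def seq_sum_union)

lemma attained_complement:
  assumes W: "seq_over G W" "zero_sum G W" "size W = w * q" and "attained q W j"
  shows "attained q W (w - j)"
proof -
  obtain T where T: "T \<subseteq># W" "size T = j * q" "zero_sum G T" using assms(4) by (auto simp: attained_def)
  have over: "seq_over G T" "seq_over G (W - T)" using T(1) W(1) by (auto intro: seq_over_subset)
  have "seq_sum G W = seq_sum G T \<otimes> seq_sum G (W - T)"
    using seq_sum_union[OF over] T(1) by simp
  with over W(2) T(3) have "zero_sum G (W - T)" by (simp add: zero_sum_def)
  moreover have "size (W - T) = (w - j) * q" using T W(3) by (simp add: size_Diff_submset diff_mult_distrib)
  ultimately show ?thesis unfolding attained_def by (meson diff_subset_eq_self)
qed

lemma attained_add:
  assumes "seq_over G S" "seq_over G T" "attained q S i" "attained q T j"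
  shows "attained q (S + T) (i + j)"
proof -
  obtain U V where "U \<subseteq># S" "size U = i * q" "zero_sum G U" "V \<subseteq># T" "size V = j * q" "zero_sum G V"
    using assms by (auto simp: attained_def)
  then have "U + V \<subseteq># S + T \<and> size (U + V) = (i + j) * q \<and> zero_sum G (U + V)"
    using assms(1,2) by (auto simp: add_mult_distrib intro: zero_sum_union seq_over_subset subset_mset.add_mono)
  then show ?thesis unfolding attained_def by blast
qed

end

subsection \<open>Subsequences of length $kq$\<close>

context comm_group begin

text \<open>Fewer than d values in [1, w - 1] are missed. They include M and its reflection x
  \<mapsto> w - x, which are disjoint because the reflection lies in [d, w - 1]. If 2 d \<le> w, the
  reflection starts at d + 1, so a missed d is an additional value.\<close>

lemma card_unattained:
  assumes hit: "\<And>c A. c \<ge> 1 \<Longrightarrow> davenport G - 1 + c * q \<le> size W \<Longrightarrow> A \<subseteq> {1..d + c - 1} \<Longrightarrow>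
      card A = d \<Longrightarrow> d + c \<le> p \<Longrightarrow> \<exists>j\<in>A. attained q W j"
    and W: "seq_over G W" "zero_sum G W" "size W = w * q" and D: "davenport G \<le> d * q"
    and w: "2 * d - 1 \<le> w" "d < w" "w \<le> p"
  defines "M \<equiv> {x \<in> {1..d - 1}. \<not> attained q W x}"
  shows "2 * card M < d"
    and "2 * d \<le> w \<Longrightarrow> \<not> attained q W d \<Longrightarrow> d \<ge> 1 \<Longrightarrow> 2 * card M + 1 < d"
proof -
  define N where "N = {x \<in> {1..w - 1}. \<not> attained q W x}"
  let ?M' = "(\<lambda>x. w - x) ` M"
  have N: "card N < d"
  proof (rule ccontr)
    assume "\<not> ?thesis"
    then obtain A where A: "A \<subseteq> N" "card A = d" by (meson not_less obtain_subset_with_card_n)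
    \<comment> \<open>Here c = w - d, which makes the range exactly [1, w - 1].\<close>
    have "w * q = d * q + (w - d) * q" using w(2) by (simp flip: add_mult_distrib)
    then have "davenport G - 1 + (w - d) * q \<le> size W" using W(3) D by simp
    moreover have "A \<subseteq> {1..d + (w - d) - 1}" using A(1) w(2) by (auto simp: N_def)
    ultimately have "\<exists>j\<in>A. attained q W j" using w A(2) by (intro hit) auto
    then obtain j where "j \<in> A" "attained q W j" by blast
    with A(1) show False by (auto simp: N_def)
  qed
  have unattained: "\<not> attained q W (w - x)" if "x \<in> M" for x
  proof
    assume "attained q W (w - x)"
    then have "attained q W (w - (w - x))" by (rule attained_complement[OF W])
    moreover have "w - (w - x) = x" using that w(1,2) by (auto simp: M_def)
    ultimately show False using that by (simp add: M_def)
  qed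
  have fin: "finite M" "finite N" by (simp_all add: M_def N_def)
  have sub: "M \<union> ?M' \<subseteq> N" using unattained w(1,2) by (auto simp: M_def N_def)
  have "M \<inter> ?M' = {}" using w(1) by (auto simp: M_def)
  moreover have "inj_on (\<lambda>x. w - x) M" using w(1,2) by (auto simp: M_def intro!: inj_onI)
  ultimately have card: "card (M \<union> ?M') = 2 * card M"
    using fin(1) by (simp add: card_Un_disjoint card_image)
  then show "2 * card M < d" using N card_mono[OF fin(2) sub] by simp
  assume *: "2 * d \<le> w" "\<not> attained q W d" "d \<ge> 1"
  then have "d \<notin> M \<union> ?M'" by (auto simp: M_def)
  moreover have "insert d (M \<union> ?M') \<subseteq> N" using sub * w(2) by (auto simp: N_def)
  ultimately show "2 * card M + 1 < d"
    using N card card_mono[OF fin(2), of "insert d (M \<union> ?M')"] fin(1) by simp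
qed

text \<open>The condition 3 d \<le> p + 1 serves the largest use of Olson's argument below the
  diagonal, c = 2 d - 1 with e = 0. The induction on k is for all S, since terms are removed from
  S.\<close>

lemma attained_if_large:
  assumes "prime p" and q: "q = p ^ m" and fin: "finite (carrier G)" and ordG: "order G = p ^ n"
    and D: "davenport G \<le> d * q" "(d - 1) * q < davenport G" and d: "d \<ge> 1" "3 * d \<le> p + 1"
    and "seq_over G S" "(k + 2 * d - 2) * q + 3 * davenport G - 3 \<le> size S" "d \<le> k"
  shows "attained q S k"
  using assms(9-11)
proof (induction k arbitrary: S rule: less_induct)
  case (less k)
  define D' where "D' = davenport G - 1"
  have D': "davenport G = Suc D'" using D(2) by (simp add: D'_def)
  have p2: "p \<ge> 2" using assms(1) by (rule prime_ge_2_nat)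
  have S: "seq_over G S" by fact
  have sub_over: "seq_over G T" if "T \<subseteq># S" for T using seq_over_subset[OF S that] .
  have hit: "\<exists>j\<in>A. attained q T j"
    if "T \<subseteq># S" "c \<ge> 1" "davenport G - 1 + c * q \<le> size T" "A \<subseteq> {1..d + c - 1}" "card A = d" "d + c \<le> p"
    for T c A
    using attained_if_card_eq[OF assms(1) q fin ordG D(1) sub_over[OF that(1)] that(3,2,4,5,6)] .
  obtain e where e: "k = d + e" using less.prems(3) le_Suc_ex by blast
  have size: "(3 * d + e - 2) * q + 3 * D' \<le> size S"
    using less.prems(2) e D' by (simp add: algebra_simps)
  show ?case
  proof (rule ccontr)
    assume notk: "\<not> attained q S k"
    \<comment> \<open>Removing jq terms lowers the length bound exactly to that for k - j, and j
      \<le> e keeps k - j \<ge> d.\<close>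
    have low: "\<not> attained q S j" if j: "1 \<le> j" "j \<le> e" for j
    proof
      assume "attained q S j"
      then obtain T where T: "T \<subseteq># S" "size T = j * q" "zero_sum G T" by (auto simp: attained_def)
      have "(k + 2 * d - 2) * q = (k - j + 2 * d - 2) * q + j * q"
        using j e d(1) by (simp flip: add_mult_distrib)
      then have "(k - j + 2 * d - 2) * q + 3 * davenport G - 3 \<le> size (S - T)"
        using T less.prems(2) D' by (simp add: size_Diff_submset)
      then have "attained q (S - T) (k - j)"
        using less.IH[of "k - j" "S - T"] j e d(1) sub_over[of "S - T"] by simp
      moreover have "attained q T j" using T by (auto simp: attained_def)
      ultimately have "attained q (T + (S - T)) (j + (k - j))"
        using T(1) sub_over by (intro attained_add) auto
      then show False using T(1) notk j e by simp
    qed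
    have no: "\<not> attained q T j" if "T \<subseteq># S" "j \<in> insert k {1..e}" for T j
      using low[of j] notk attained_mono[of q T j S] that by auto
    show False
    proof (cases "d \<le> Suc e")
      case True
      \<comment> \<open>A set of d unattained values in [1, 2 d - 1]: either [1, d], or [1, d - 1]
        with k, which is 2 d - 1 if e = d - 1.\<close>
      define a where "a = (if d \<le> e then d else k)"
      have a: "a = d \<and> d \<le> e \<or> a = k \<and> d = Suc e" using True by (auto simp: a_def)
      let ?A = "insert a {1..d - 1}"
      have "card ?A = d" using a d(1) e by auto
      moreover have "?A \<subseteq> {1..d + d - 1}" using a d(1) e by auto
      moreover have "d + d \<le> p" using d p2 by auto
      moreover have "d * q \<le> (3 * d + e - 2) * q" using d(1) by (intro mult_right_mono) auto
      then have "davenport G - 1 + d * q \<le> size S" using size D' by linarith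
      ultimately have "\<exists>j\<in>?A. attained q S j" using d(1) by (intro hit) simp_all
      then obtain j where j: "j \<in> ?A" "attained q S j" by blast
      then have "j \<in> insert k {1..e}" using a d(1) by auto
      with no[OF subset_mset.order_refl] j(2) show False by blast
    next
      case False
      \<comment> \<open>The e + 1 unattained values need f + 1 further ones to make d; hence the
        windows below are [lo, lo + f], the upper end of the range for c = lo - e - 1.\<close>
      then obtain f where f: "d = e + 2 + f"
        by (metis add_2_eq_Suc' add_Suc le_Suc_ex not_less_eq_eq)
      have window: "\<exists>W w. W \<subseteq># T \<and> lo \<le> w \<and> w \<le> lo + f \<and> size W = w * q \<and> zero_sum G W"
        if "T \<subseteq># S" "k < lo" "lo \<le> 2 * d" "davenport G - 1 + (lo - Suc e) * q \<le> size T" for T lo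
      proof -
        let ?A = "insert k {1..e} \<union> {lo..lo + f}"
        have "card ?A = d"
        proof -
          have "card (insert k {1..e}) = Suc e" using e f by simp
          moreover have "insert k {1..e} \<inter> {lo..lo + f} = {}" using that(2) e by auto
          ultimately show ?thesis using f by (subst card_Un_disjoint) auto
        qed
        moreover have "?A \<subseteq> {1..d + (lo - Suc e) - 1}" using that(2) e f by auto
        moreover have "d + (lo - Suc e) \<le> p" using that(2,3) e f d(2) by simp
        moreover have "1 \<le> lo - Suc e" using that(2) e f by simp
        ultimately have "\<exists>j\<in>?A. attained q T j" using that(1,4) by (intro hit)
        then obtain j where j: "j \<in> ?A" "attained q T j" by blast
        then have "j \<in> {lo..lo + f}" using no[OF that(1)] by blast
        with j(2) show ?thesis by (auto simp: attained_def)
      qed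
      have "davenport G - 1 + (2 * d - Suc e) * q \<le> size S"
      proof -
        have "(2 * d - Suc e) * q \<le> (3 * d + e - 2) * q" using f by (intro mult_right_mono) auto
        then show ?thesis using size D' by linarith
      qed
      then obtain W1 w1 where W1: "W1 \<subseteq># S" "2 * d \<le> w1" "w1 \<le> 2 * d + f" "size W1 = w1 * q" "zero_sum G W1"
        using window[of S "2 * d"] e f by auto
      \<comment> \<open>At least 2eq + 3D' terms remain: one D' is the D(G) - 1 of the bound, and
        the other two cover (2 d - 2) q because (d - 1) q \<le> D'.\<close>
      have "davenport G - 1 + (2 * d - 1 - Suc e) * q \<le> size (S - W1)"
      proof -
        have "w1 * q \<le> (2 * d + f) * q" using W1(3) by (rule mult_right_mono) simp
        moreover have "(d - 1) * q \<le> D'" using D(2) D' by simp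
        ultimately show ?thesis using size W1(1,4) D' f
          by (simp add: size_Diff_submset algebra_simps)
      qed
      then obtain W2 w2 where W2: "W2 \<subseteq># S - W1" "2 * d - 1 \<le> w2" "w2 \<le> 2 * d - 1 + f"
          "size W2 = w2 * q" "zero_sum G W2"
        using window[of "S - W1" "2 * d - 1"] e f by auto
      have W2S: "W2 \<subseteq># S" using W2(1) by (meson diff_subset_eq_self subset_mset.order_trans)
      define M where "M W = {x \<in> {1..d - 1}. \<not> attained q W x}" for W
      \<comment> \<open>For e = 0 the unattained k equals d, and w1 \<ge> 2 d gives the sharper
        estimate.\<close>
      have M1: "2 * card (M W1) < d" "e = 0 \<Longrightarrow> 2 * card (M W1) + 1 < d"
        unfolding M_def
        using card_unattained[OF hit[OF W1(1)] sub_over[OF W1(1)] W1(5,4) D(1)] W1(2,3) f d(2) e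
          no[OF W1(1), of k] by auto
      have M2: "2 * card (M W2) < d"
        unfolding M_def
        using card_unattained(1)[OF hit[OF W2S] sub_over[OF W2S] W2(5,4) D(1)] W2(2,3) f d(2) by auto
      \<comment> \<open>Since k = d + e, the map x \<mapsto> k - x preserves [e + 1, d - 1]. Without
        such x, the misses of W1 and the reflected misses of W2 would cover this interval.\<close>
      have "\<exists>x\<in>{e + 1..d - 1}. attained q W1 x \<and> attained q W2 (k - x)"
      proof (rule ccontr)
        assume contra: "\<not> ?thesis"
        have finM: "finite (M W)" for W by (simp add: M_def)
        have low_M: "{1..e} \<subseteq> M W" if "W \<subseteq># S" for W
          using no[OF that] f by (auto simp: M_def)
        have "{e + 1..d - 1} \<subseteq> (M W1 - {1..e}) \<union> (\<lambda>x. k - x) ` (M W2 - {1..e})"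
        proof
          fix x assume x: "x \<in> {e + 1..d - 1}"
          show "x \<in> (M W1 - {1..e}) \<union> (\<lambda>x. k - x) ` (M W2 - {1..e})"
          proof (cases "attained q W1 x")
            case True
            with contra x have "\<not> attained q W2 (k - x)" by blast
            with x e have "k - x \<in> M W2 - {1..e}" "x = k - (k - x)" by (auto simp: M_def)
            then show ?thesis by blast
          next
            case False
            with x show ?thesis by (auto simp: M_def)
          qed
        qed
        then have "card {e + 1..d - 1} \<le> card ((M W1 - {1..e}) \<union> (\<lambda>x. k - x) ` (M W2 - {1..e}))"
          by (intro card_mono) (auto simp: finM)
        also have "\<dots> \<le> card (M W1 - {1..e}) + card (M W2 - {1..e})"
          by (meson add_left_mono card_Un_le card_image_le finM finite_Diff le_trans)
        also have "\<dots> = (card (M W1) - e) + (card (M W2) - e)"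
          using low_M[OF W1(1)] low_M[OF W2S] by (simp add: card_Diff_subset)
        finally have "d - 1 - e \<le> (card (M W1) - e) + (card (M W2) - e)" by simp
        moreover have "e \<le> card (M W1)" "e \<le> card (M W2)"
          using card_mono[OF finM low_M[OF W1(1)]] card_mono[OF finM low_M[OF W2S]] by simp_all
        \<comment> \<open>Covering needs d - 1 + e misses in total, but there are at most d - 1; for
          e = 0 the sharper bound on \<open>M W1\<close> is decisive.\<close>
        ultimately show False using M1 M2 f by (cases "e = 0") linarith+
      qed
      then obtain x where x: "x \<in> {e + 1..d - 1}" "attained q W1 x" "attained q W2 (k - x)" by blast
      then have "attained q (W1 + W2) (x + (k - x))"
        using sub_over[OF W1(1)] sub_over[OF W2S] by (intro attained_add)
      moreover have "W1 + W2 \<subseteq># S" using W1(1) W2(1)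
        by (metis subset_mset.add_diff_inverse subset_mset.add_left_mono)
      ultimately show False using notk x(1) e by (auto dest: attained_mono)
    qed
  qed
qed

lemma group_exp_eq_prime_power:
  assumes "prime p" "finite (carrier G)" "order G = p ^ n"
  obtains m where "group_exp G = p ^ m"
proof -
  have "group_exp G \<in> ord ` carrier G"
    unfolding group_exp_def using assms(2) one_closed by (intro Max_in) auto
  then obtain g where "g \<in> carrier G" "group_exp G = ord g" by auto
  then have "group_exp G dvd p ^ n" using ord_dvd_group_order assms(3) by metis
  then show ?thesis using assms(1) divides_primepow_nat that by blast
qed

end

theorem theorem5:
  fixes G :: "('a, 'b) monoid_scheme" and p q d k n :: nat
  assumes "prime p"
    and "comm_group G" and "finite (carrier G)" and "order G = p ^ n"
    and "group_exp G = q"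
    and "\<lceil>real (davenport G) / real q\<rceil> = int d"
    and "int p \<ge> 2 * int d + 3 * \<lceil>real (davenport G) / (2 * real q)\<rceil> - 3"
    and "k \<ge> d"
  shows "s_const (k * q) G \<le> enat ((k + 2 * d - 2) * q + 3 * davenport G - 3)"
proof -
  interpret comm_group G by fact
  obtain m where q: "q = p ^ m" using group_exp_eq_prime_power[OF assms(1,3,4)] assms(5) by metis
  have q0: "q > 0" using q assms(1) by (simp add: prime_gt_0_nat)
  have D0: "davenport G > 0" by (rule davenport_property(1)[OF assms(1,3,4)])
  \<comment> \<open>The ceiling means (d - 1) q < D(G) \<le> dq.\<close>
  have "real (davenport G) / real q \<le> real d" "real d < real (davenport G) / real q + 1"
    using assms(6) by linarith+
  then have Dr: "real (davenport G) \<le> real d * real q" "(real d - 1) * real q < real (davenport G)"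
    using q0 by (simp_all add: field_simps)
  have D: "davenport G \<le> d * q" using Dr(1) by (simp flip: of_nat_mult)
  have d: "d \<ge> 1" using D D0 by (cases d) auto
  then have "real ((d - 1) * q) < real (davenport G)" using Dr(2) by (simp add: of_nat_diff)
  then have D2: "(d - 1) * q < davenport G" by linarith
  define h where "h = \<lceil>real (davenport G) / (2 * real q)\<rceil>"
  have "real d - 1 < 2 * (real (davenport G) / (2 * real q))"
    using Dr(2) q0 by (simp add: field_simps)
  also have "\<dots> \<le> 2 * real_of_int h" unfolding h_def by (simp only: mult_left_mono le_of_int_ceiling)
  finally have "int d \<le> 2 * h" by linarith
  \<comment> \<open>From 2 h \<ge> d, the lower bound 2 d + 3 h - 3 on p is at least 3 d - 1 except
    for d = 2, h = 1, where it is 4 and primality gives p \<ge> 5.\<close>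
  moreover have "p \<noteq> 4" using assms(1) prime_odd_nat[of p] by auto
  ultimately have p: "3 * d \<le> p + 1"
    using assms(7) prime_ge_2_nat[OF assms(1)] d unfolding h_def[symmetric] by presburger
  let ?L = "(k + 2 * d - 2) * q + 3 * davenport G - 3"
  have "(k + 2 * d - 2) * q > 0" using q0 d assms(8) by simp
  then have "?L > 0" using D0 by linarith
  moreover have "\<exists>T. T \<subseteq># S \<and> size T = k * q \<and> zero_sum G T" if "seq_over G S" "?L \<le> size S" for S
    using attained_if_large[OF assms(1) q assms(3,4) D D2 d p that assms(8)] by (simp add: attained_def)
  ultimately show ?thesis unfolding s_const_def by (intro Inf_lower imageI) auto
qed

end
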